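(* Let $\mathcal{X},\mathcal{Y}\subset\mathbb{R}^d$ and let $\alpha$, $\beta$ be probability measures with compact supports on $\mathcal{X}$ and $\mathcal{Y}$ respectively. For $\pi\in\Pi(\alpha,\beta)$ let $\mathbf{U}(\pi)\boldsymbol{\Sigma}(\pi)\mathbf{V}(\pi)^\top$ be a singular value decomposition of the $d\times d$ matrix $\int_{\mathcal{X}\times\mathcal{Y}}yx^\top\,d\pi(x,y)$, and define $$\mathcal{Q}(\pi)=\int_{\mathcal{X}\times\mathcal{Y}}\left\|\mathbf{U}(\pi)\mathbf{V}(\pi)^\top x-y\right\|^2d\pi(x,y).$$ Then $\mathcal{Q}$ is a concave function on $\Pi(\alpha,\beta)$, and the Wasserstein Procrustes problem $$\min_{\pi\in\Pi(\alpha,\beta)}\ \min_{\mathbf{C}\in\mathcal{O}_d}\int_{\mathcal{X}\times\mathcal{Y}}\|\mathbf{C}x-y\|^2\,d\pi(x,y)$$ is equivalent to the problem $\min_{\pi\in\Pi(\alpha,\beta)}\mathcal{Q}(\pi)$, i.e. the two problems have the same minimizers $\pi$ in $\Pi(\alpha,\beta)$.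
   Context: $\Pi(\alpha,\beta)$ is the set of couplings of $\alpha$ and $\beta$ (probability measures on $\mathcal{X}\times\mathcal{Y}$ with marginals $\alpha$ and $\beta$), and $\mathcal{O}_d$ is the set of $d\times d$ orthogonal matrices. In the singular value decomposition, $\mathbf{U}(\pi),\mathbf{V}(\pi)$ are $d\times d$ orthogonal matrices and $\boldsymbol{\Sigma}(\pi)$ is diagonal with nonnegative entries. Two minimization problems are called equivalent (or one an instance of the other) when they have the same minimizers in $\Pi(\alpha,\beta)$; a coupling $\pi$ is a minimizer of the first problem when it minimizes $\pi\mapsto\min_{\mathbf{C}\in\mathcal{O}_d}\int\|\mathbf{C}x-y\|^2d\pi$. *)

theory Defs
  imports "HOL-Probability.Probability"
begin

text \<open>
  A probability measure on a subset \<open>X\<close> of Euclidean space lives on \<open>restrict_space borel X\<close>, the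
  Borel \<open>\<sigma>\<close>-algebra of the subspace \<open>X\<close>. For such a measure the following is the usual topological
  support, relative to \<open>X\<close>: the points of \<open>X\<close> all of whose neighbourhoods in \<open>X\<close> have positive
  measure.
\<close>

definition measure_support :: "'a::topological_space measure \<Rightarrow> 'a set" where
  "measure_support M =
     {x \<in> space M. \<forall>W. open W \<longrightarrow> x \<in> W \<longrightarrow> emeasure M (W \<inter> space M) > 0}"

definition compactly_supported_prob_on :: "'a::topological_space set \<Rightarrow> 'a measure \<Rightarrow> bool" where
  "compactly_supported_prob_on X M \<longleftrightarrow>
     prob_space M \<and> sets M = sets (restrict_space borel X) \<and> compact (measure_support M)"

definition couplings :: "'a measure \<Rightarrow> 'b measure \<Rightarrow> ('a \<times> 'b) measure set" where
  "couplings M N =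
     {P. prob_space P \<and> sets P = sets (M \<Otimes>\<^sub>M N) \<and> distr P M fst = M \<and> distr P N snd = N}"

text \<open>
  The type of measures is not a real vector space, so \<^const>\<open>concave_on\<close> does not apply to functions
  of a measure. \<open>mixture t P Q\<close> is the measure \<open>(1 - t) P + t Q\<close>, for \<open>P\<close> and \<open>Q\<close> on the same
  \<open>\<sigma>\<close>-algebra; as in \<^const>\<open>concave_on\<close>, concavity includes convexity of the domain.
\<close>

definition mixture :: "real \<Rightarrow> 'a measure \<Rightarrow> 'a measure \<Rightarrow> 'a measure" where
  "mixture t P Q = measure_of (space P) (sets P)
     (\<lambda>A. ennreal (1 - t) * emeasure P A + ennreal t * emeasure Q A)"

lemma
  shows space_mixture: "space (mixture t P Q) = space P"
    and sets_mixture: "sets (mixture t P Q) = sets P"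
  by (simp_all add: mixture_def)

lemma emeasure_mixture:
  assumes "sets Q = sets P" and "A \<in> sets P"
  shows "emeasure (mixture t P Q) A = ennreal (1 - t) * emeasure P A + ennreal t * emeasure Q A"
proof (rule emeasure_measure_of[OF mixture_def])
  show "countably_additive (sets (mixture t P Q))
      (\<lambda>A. ennreal (1 - t) * emeasure P A + ennreal t * emeasure Q A)"
    unfolding countably_additive_def sets_mixture
  proof (intro allI impI)
    fix F :: "nat \<Rightarrow> 'a set"
    assume F: "range F \<subseteq> sets P" "disjoint_family F"
    have "(\<Sum>i. emeasure P (F i)) = emeasure P (\<Union>i. F i)"
      "(\<Sum>i. emeasure Q (F i)) = emeasure Q (\<Union>i. F i)"
      using F assms(1) by (auto intro!: suminf_emeasure)
    then show "(\<Sum>i. ennreal (1 - t) * emeasure P (F i) + ennreal t * emeasure Q (F i)) =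
        ennreal (1 - t) * emeasure P (\<Union>i. F i) + ennreal t * emeasure Q (\<Union>i. F i)"
      by (simp add: suminf_add[symmetric] summableI)
  qed
qed (use assms sets.sets_into_space in \<open>auto simp: sets_mixture positive_def\<close>)

definition concave_on_measures :: "'a measure set \<Rightarrow> ('a measure \<Rightarrow> real) \<Rightarrow> bool" where
  "concave_on_measures S F \<longleftrightarrow>
     (\<forall>P\<in>S. \<forall>Q\<in>S. \<forall>t\<in>{0..1}.
        mixture t P Q \<in> S \<and> (1 - t) * F P + t * F Q \<le> F (mixture t P Q))"

definition is_svd :: "real^'d^'d \<Rightarrow> real^'d^'d \<Rightarrow> real^'d^'d \<Rightarrow> real^'d^'d \<Rightarrow> bool" where
  "is_svd A U D V \<longleftrightarrow>
     orthogonal_matrix U \<and> orthogonal_matrix V \<and>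
     (\<forall>i j. i \<noteq> j \<longrightarrow> D $ i $ j = 0) \<and> (\<forall>i. 0 \<le> D $ i $ i) \<and>
     A = U ** D ** transpose V"

definition cross_moment :: "((real^'d) \<times> (real^'d)) measure \<Rightarrow> real^'d^'d" where
  "cross_moment P = (LINT (x, y)|P. columnvector y ** (rowvector x :: real^'d^1))"

definition transport_cost :: "real^'d^'d \<Rightarrow> ((real^'d) \<times> (real^'d)) measure \<Rightarrow> real" where
  "transport_cost C P = (LINT (x, y)|P. (norm (C *v x - y))\<^sup>2)"

text \<open>
  \<open>LEAST\<close> is the minimum over \<open>C\<close>; \<open>procrustes_cost_attained\<close> below shows that it is attained.
\<close>

definition procrustes_cost :: "((real^'d) \<times> (real^'d)) measure \<Rightarrow> real" where
  "procrustes_cost P = (LEAST c. \<exists>C. orthogonal_matrix C \<and> c = transport_cost C P)"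

lemma AE_measure_support:
  fixes M :: "'a::second_countable_topology measure"
  assumes "compactly_supported_prob_on X M"
  shows "AE x in M. x \<in> measure_support M"
proof -
  have sets: "sets M = sets (restrict_space borel X)" and sp: "space M = X"
    using assms sets_eq_imp_space_eq[of M "restrict_space borel X"]
    by (auto simp: compactly_supported_prob_on_def space_restrict_space)
  have W: "W \<inter> space M \<in> sets M" if "open W" for W
    using that unfolding sets sp sets_restrict_space Int_commute[of W]
    by (intro imageI) simp
  define \<F> where "\<F> = {W. open W \<and> emeasure M (W \<inter> space M) = 0}"
  obtain \<G> where G: "\<G> \<subseteq> \<F>" "countable \<G>" "\<Union>\<G> = \<Union>\<F>"
    using Lindelof[of \<F>] unfolding \<F>_def by auto
  have "(\<Union>W\<in>\<G>. W \<inter> space M) \<in> null_sets M"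
  proof (rule null_sets_UN'[OF G(2)])
    fix W assume "W \<in> \<G>"
    then have "open W" "emeasure M (W \<inter> space M) = 0"
      using G(1) by (auto simp: \<F>_def)
    then show "W \<inter> space M \<in> null_sets M"
      using W by (intro null_setsI)
  qed
  moreover have "{x \<in> space M. x \<notin> measure_support M} \<subseteq> (\<Union>W\<in>\<G>. W \<inter> space M)"
  proof
    fix x assume "x \<in> {x \<in> space M. x \<notin> measure_support M}"
    then obtain W where "x \<in> space M" "open W" "x \<in> W" "emeasure M (W \<inter> space M) = 0"
      by (auto simp: measure_support_def zero_less_iff_neq_zero)
    then have "x \<in> space M" "x \<in> \<Union>\<G>"
      unfolding G(3) \<F>_def by blast+
    then show "x \<in> (\<Union>W\<in>\<G>. W \<inter> space M)"
      by blast
  qed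
  ultimately show ?thesis by (rule AE_I')
qed

lemma compact_orthogonal_matrices: "compact {C :: real^'d^'d. orthogonal_matrix C}"
proof -
  have c: "continuous_on UNIV (\<lambda>C :: real^'d^'d. transpose C ** C)"
    "continuous_on UNIV (\<lambda>C :: real^'d^'d. C ** transpose C)"
    unfolding matrix_matrix_mult_def transpose_def
    by (auto intro!: continuous_intros)
  have "{C :: real^'d^'d. orthogonal_matrix C} =
      {C. transpose C ** C = mat 1} \<inter> {C. C ** transpose C = mat 1}"
    by (auto simp: orthogonal_matrix_def)
  moreover have "closed ({C. transpose C ** C = mat 1} \<inter> {C :: real^'d^'d. C ** transpose C = mat 1})"
    using c by (intro closed_Int closed_Collect_eq) auto
  moreover have "bounded {C :: real^'d^'d. orthogonal_matrix C}"
  proof (rule boundedI)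
    fix C :: "real^'d^'d" assume "C \<in> {C. orthogonal_matrix C}"
    then have "norm (row i C) = 1" for i
      by (simp add: orthogonal_matrix_orthonormal_rows)
    then have "norm (C $ i) = 1" for i
      by (simp add: row_def)
    then show "norm C \<le> sqrt (real CARD('d))"
      by (simp add: norm_vec_def[of C] L2_set_def)
  qed
  ultimately show ?thesis by (simp add: compact_eq_bounded_closed)
qed

lemma procrustes_cost_attained:
  fixes M N :: "(real^'d) measure"
  assumes M: "compactly_supported_prob_on X M" and N: "compactly_supported_prob_on Y N"
    and P: "P \<in> couplings M N"
  obtains C where "orthogonal_matrix C" "procrustes_cost P = transport_cost C P"
    "\<And>C'. orthogonal_matrix C' \<Longrightarrow> transport_cost C P \<le> transport_cost C' P"
proof -
  interpret prob_space P using P by (simp add: couplings_def)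
  have sP: "sets P = sets (M \<Otimes>\<^sub>M N)" and d: "distr P M fst = M" "distr P N snd = N"
    using P by (auto simp: couplings_def)
  have id_borel: "(\<lambda>x. x) \<in> borel_measurable L" if "compactly_supported_prob_on Z L"
    for Z and L :: "(real^'d) measure"
  proof -
    have "(\<lambda>x. x) \<in> borel_measurable (restrict_space borel Z)"
      by (intro measurable_restrict_space1) simp
    then show ?thesis
      using that by (simp add: compactly_supported_prob_on_def cong: measurable_cong_sets)
  qed
  have fM: "fst \<in> measurable P M" "snd \<in> measurable P N"
    using measurable_cong_sets[OF sP refl] by auto
  have bm[measurable]: "fst \<in> borel_measurable P" "snd \<in> borel_measurable P"
    using measurable_compose[OF fM(1) id_borel[OF M]] measurable_compose[OF fM(2) id_borel[OF N]] by auto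
  obtain B where B: "\<And>x. x \<in> measure_support M \<Longrightarrow> norm x \<le> B"
    using M compact_imp_bounded[of "measure_support M"] 
    by (auto simp: compactly_supported_prob_on_def bounded_iff)
  obtain B' where B': "\<And>x. x \<in> measure_support N \<Longrightarrow> norm x \<le> B'"
    using N compact_imp_bounded[of "measure_support N"] 
    by (auto simp: compactly_supported_prob_on_def bounded_iff)
  have "AE x in distr P M fst. norm x \<le> B"
    using AE_measure_support[OF M] B unfolding d by (auto elim: eventually_mono)
  then have AB: "AE z in P. norm (fst z) \<le> B"
    by (rule AE_distrD[OF fM(1)])
  have "AE x in distr P N snd. norm x \<le> B'"
    using AE_measure_support[OF N] B' unfolding d by (auto elim: eventually_mono)
  then have AB': "AE z in P. norm (snd z) \<le> B'"
    by (rule AE_distrD[OF fM(2)])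
  have bound: "AE z in P. norm ((norm (C *v fst z - snd z))\<^sup>2) \<le> (B + B')\<^sup>2"
    if "orthogonal_matrix C" for C :: "real^'d^'d"
    using AB AB'
  proof eventually_elim
    case (elim z)
    have "norm (C *v fst z) = norm (fst z)"
      using that by (intro orthogonal_transformation_norm) (simp add: orthogonal_transformation_matrix)
    then have "norm (C *v fst z - snd z) \<le> B + B'"
      using elim norm_triangle_ineq4[of "C *v fst z" "snd z"] by linarith
    then show ?case by (simp add: power_mono)
  qed
  have "continuous_on {C. orthogonal_matrix C} (\<lambda>C. transport_cost C P)"
    unfolding continuous_on_sequentially
  proof (intro allI ballI impI)
    fix A :: "nat \<Rightarrow> real^'d^'d" and C
    assume A: "(\<forall>n. A n \<in> {C. orthogonal_matrix C}) \<and> A \<longlonglongrightarrow> C"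
    have meas: "(\<lambda>z. (norm (D *v fst z - snd z))\<^sup>2) \<in> borel_measurable P" for D :: "real^'d^'d"
    proof -
      have [measurable]: "(*v) D \<in> borel_measurable borel"
        by (intro borel_measurable_continuous_onI continuous_intros)
      show ?thesis by measurable
    qed
    have "(\<lambda>n. A n *v x) \<longlonglongrightarrow> C *v x" for x
      using A unfolding matrix_vector_mult_def by (auto intro!: tendsto_intros)
    then have lim: "AE z in P. (\<lambda>n. (norm (A n *v fst z - snd z))\<^sup>2) \<longlonglongrightarrow> (norm (C *v fst z - snd z))\<^sup>2"
      by (auto intro!: tendsto_intros)
    show "((\<lambda>C. transport_cost C P) \<circ> A) \<longlonglongrightarrow> transport_cost C P"
      unfolding transport_cost_def o_def case_prod_beta
      by (rule integral_dominated_convergence[OF meas meas _ lim, of "\<lambda>_. (B + B')\<^sup>2"])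
        (use A bound in auto)
  qed
  moreover have "{C :: real^'d^'d. orthogonal_matrix C} \<noteq> {}"
    using orthogonal_matrix_id by blast
  ultimately obtain C where C: "orthogonal_matrix C"
    "\<And>C'. orthogonal_matrix C' \<Longrightarrow> transport_cost C P \<le> transport_cost C' P"
    using continuous_attains_inf[OF compact_orthogonal_matrices, of "\<lambda>C. transport_cost C P"]
    by blast
  moreover from C have "procrustes_cost P = transport_cost C P"
    unfolding procrustes_cost_def by (intro Least_equality) auto
  ultimately show ?thesis using that by blast
qed

text \<open>
  The singular value decomposition is not unique, so \<open>svd_cost\<close> takes the chosen factors
  \<open>U(\<pi>)\<close>, \<open>V(\<pi>)\<close> as parameters.
\<close>

definition svd_cost ::
  "(((real^'d) \<times> (real^'d)) measure \<Rightarrow> real^'d^'d) \<Rightarrow>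
   (((real^'d) \<times> (real^'d)) measure \<Rightarrow> real^'d^'d) \<Rightarrow>
   ((real^'d) \<times> (real^'d)) measure \<Rightarrow> real" where
  "svd_cost U V P = transport_cost (U P ** transpose (V P)) P"

end

(*
  Expanding the square, the cost of an orthogonal C at a coupling p equals a constant (depending
  only on p) minus 2 <C, A>, where A is the cross moment of p and <.,.> the Frobenius inner
  product. If A = U D V^T, then <C, A> = <U^T C V, D> is at most the trace of D, because the
  entries of the orthogonal matrix U^T C V are at most 1; equality holds for C = U V^T. So Q is
  the minimum over C of the costs, which are affine in p, and hence is concave.
*)
theory Submission
  imports Defs
begin

section \<open>Mixtures of measures\<close>

text \<open>The weights add up to 1. This is what keeps the marginals fixed when two couplings of
  the same measures are mixed.\<close>

lemma mixture_self:
  assumes "t \<in> {0..1}"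
  shows "mixture t M M = M"
proof (rule measure_eqI)
  fix A assume "A \<in> sets (mixture t M M)"
  moreover have "ennreal (1 - t) + ennreal t = 1"
    using assms by (simp flip: ennreal_plus)
  ultimately show "emeasure (mixture t M M) A = emeasure M A"
    by (simp add: emeasure_mixture sets_mixture flip: distrib_right)
qed (simp add: sets_mixture)

lemma measurable_mixture_iff: "f \<in> measurable (mixture t P Q) N \<longleftrightarrow> f \<in> measurable P N"
  by (simp add: sets_mixture cong: measurable_cong_sets)

lemma distr_mixture:
  assumes sets: "sets Q = sets P" and f: "f \<in> measurable P N"
  shows "distr (mixture t P Q) N f = mixture t (distr P N f) (distr Q N f)"
proof (rule measure_eqI)
  fix A assume "A \<in> sets (distr (mixture t P Q) N f)"
  then have A: "A \<in> sets N" by simp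
  have "f \<in> measurable Q N" "f \<in> measurable (mixture t P Q) N"
    using f sets by (simp_all add: measurable_mixture_iff cong: measurable_cong_sets)
  moreover have "space Q = space P"
    using sets by (rule sets_eq_imp_space_eq)
  ultimately show "emeasure (distr (mixture t P Q) N f) A =
      emeasure (mixture t (distr P N f) (distr Q N f)) A"
    using A f sets by (simp add: emeasure_mixture emeasure_distr space_mixture)
qed (simp add: sets_mixture)

text \<open>For indicators this is the definition of the mixture; scaling, sums and monotone limits
  extend it to all nonnegative measurable functions.\<close>

lemma nn_integral_mixture:
  assumes sets: "sets Q = sets P" and f: "f \<in> borel_measurable P"
  shows "(\<integral>\<^sup>+x. f x \<partial>mixture t P Q) = ennreal (1 - t) * (\<integral>\<^sup>+x. f x \<partial>P) + ennreal t * (\<integral>\<^sup>+x. f x \<partial>Q)"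
proof -
  note [measurable_cong] = sets sets_mixture[of t P Q]
  have space: "space Q = space P"
    using sets by (rule sets_eq_imp_space_eq)
  show ?thesis
    using f
  proof (induction rule: borel_measurable_induct)
    case (cong f g)
    then show ?case
      by (simp add: space space_mixture cong: nn_integral_cong_simp)
  next
    case (set A)
    then show ?case
      using sets by (simp add: emeasure_mixture sets_mixture)
  next
    case (mult u c)
    note [measurable] = mult.hyps(2)
    show ?case
      by (simp add: nn_integral_cmult mult.IH distrib_left mult.left_commute)
  next
    case (add u v)
    note [measurable] = add.hyps(1,3)
    show ?case
      by (simp add: nn_integral_add add.IH distrib_left add_ac)
  next
    case (seq F)
    have [measurable]: "F i \<in> borel_measurable P" for i
      by (rule seq.hyps)
    \<comment> \<open>Monotonicity in \<open>i\<close> is what allows the supremum of the sum to be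
      split into the sum of the suprema.\<close>
    have "incseq (\<lambda>i. ennreal s * (\<integral>\<^sup>+x. F i x \<partial>M))" for s and M :: "'a measure"
      using seq.hyps(3) by (auto simp: incseq_def le_fun_def intro!: mult_left_mono nn_integral_mono)
    then show ?case
      using seq.hyps(3)
      by (simp add: image_image nn_integral_monotone_convergence_SUP seq.IH
          ennreal_SUP_add SUP_mult_left_ennreal)
  qed
qed

text \<open>Nonnegativity lets the Bochner integral be read off from the \<open>ennreal\<close> one.
  This suffices here, since the cost integrand is a square.\<close>

lemma integral_mixture_nonneg:
  fixes f :: "'a \<Rightarrow> real"
  assumes sets: "sets Q = sets P" and t: "t \<in> {0..1}"
    and f: "integrable P f" "integrable Q f" and nonneg: "\<And>x. 0 \<le> f x"
  shows "integral\<^sup>L (mixture t P Q) f = (1 - t) * integral\<^sup>L P f + t * integral\<^sup>L Q f"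
proof -
  have m: "f \<in> borel_measurable P"
    using f by auto
  have "(\<integral>\<^sup>+x. ennreal (f x) \<partial>mixture t P Q) =
      ennreal (1 - t) * ennreal (integral\<^sup>L P f) + ennreal t * ennreal (integral\<^sup>L Q f)"
    using m sets f nonneg by (simp add: nn_integral_mixture nn_integral_eq_integral)
  also have "\<dots> = ennreal ((1 - t) * integral\<^sup>L P f + t * integral\<^sup>L Q f)"
    using t nonneg by (simp add: ennreal_mult ennreal_plus)
  finally have "(\<integral>\<^sup>+x. ennreal (f x) \<partial>mixture t P Q) =
      ennreal ((1 - t) * integral\<^sup>L P f + t * integral\<^sup>L Q f)" .
  moreover have "0 \<le> (1 - t) * integral\<^sup>L P f + t * integral\<^sup>L Q f"
    using t nonneg by simp
  moreover have "f \<in> borel_measurable (mixture t P Q)"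
    using m by (simp add: measurable_mixture_iff)
  ultimately show ?thesis
    using nonneg by (simp add: integral_eq_nn_integral del: ennreal_plus)
qed

section \<open>Couplings\<close>

text \<open>This is the convexity of the domain that \<open>concave_on_measures\<close> demands.
  Pushing forward commutes with mixing, so each marginal is a mixture of one measure with
  itself.\<close>

lemma mixture_in_couplings:
  assumes P: "P \<in> couplings M N" and Q: "Q \<in> couplings M N" and t: "t \<in> {0..1}"
  shows "mixture t P Q \<in> couplings M N"
proof -
  interpret P: prob_space P using P by (simp add: couplings_def)
  have sP: "sets P = sets (M \<Otimes>\<^sub>M N)" and sQ: "sets Q = sets P"
    using P Q by (simp_all add: couplings_def)
  have f: "fst \<in> measurable P M" "snd \<in> measurable P N"
    using measurable_cong_sets[OF sP refl] by auto
  have d: "distr (mixture t P Q) M fst = M" "distr (mixture t P Q) N snd = N"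
    using P Q t f sQ by (simp_all add: distr_mixture mixture_self couplings_def)
  have "prob_space M"
    using P.prob_space_distr[OF f(1)] P by (simp add: couplings_def)
  \<comment> \<open>The total mass is read off from the first marginal, which is already known to be
    \<open>M\<close>.\<close>
  then have "prob_space (mixture t P Q)"
    using f(1) d(1) by (subst prob_space_distrD[of fst _ M]) (simp_all add: measurable_mixture_iff)
  then show ?thesis
    using d sP by (simp add: couplings_def sets_mixture)
qed

lemma compactly_supported_prob_on_id_borel:
  assumes "compactly_supported_prob_on X M"
  shows "(\<lambda>x. x) \<in> borel_measurable M"
proof -
  have "(\<lambda>x. x) \<in> borel_measurable (restrict_space borel X)"
    by (intro measurable_restrict_space1) simp
  then show ?thesis
    using assms by (simp add: compactly_supported_prob_on_def cong: measurable_cong_sets)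
qed

text \<open>Almost all of \<open>P\<close> lies on the product of the two supports, which is
  compact, so \<open>f\<close> is almost everywhere bounded.\<close>

lemma integrable_coupling_continuous:
  fixes M :: "'a::second_countable_topology measure" and N :: "'b::second_countable_topology measure"
    and f :: "'a \<times> 'b \<Rightarrow> 'c::{banach, second_countable_topology}"
  assumes M: "compactly_supported_prob_on X M" and N: "compactly_supported_prob_on Y N"
    and P: "P \<in> couplings M N" and f: "continuous_on UNIV f"
  shows "integrable P f"
proof -
  interpret prob_space P using P by (simp add: couplings_def)
  have sP: "sets P = sets (M \<Otimes>\<^sub>M N)" and d: "distr P M fst = M" "distr P N snd = N"
    using P by (auto simp: couplings_def)
  have fM: "fst \<in> measurable P M" "snd \<in> measurable P N"
    using measurable_cong_sets[OF sP refl] by auto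
  have "fst \<in> borel_measurable P" "snd \<in> borel_measurable P"
    using measurable_compose[OF fM(1) compactly_supported_prob_on_id_borel[OF M]]
      measurable_compose[OF fM(2) compactly_supported_prob_on_id_borel[OF N]] by auto
  \<comment> \<open>The sigma-algebra of \<open>P\<close> is a product of trace sigma-algebras, so
    \<open>f\<close> is composed with the two Borel measurable projections.\<close>
  then have f_meas: "f \<in> borel_measurable P"
    using borel_measurable_continuous_Pair[of fst P snd "\<lambda>x y. f (x, y)"] f by simp
  let ?K = "measure_support M \<times> measure_support N"
  have "compact (f ` ?K)"
    using M N f by (intro compact_continuous_image compact_Times)
      (auto simp: compactly_supported_prob_on_def elim: continuous_on_subset)
  then obtain B where B: "\<And>z. z \<in> ?K \<Longrightarrow> norm (f z) \<le> B"
    using compact_imp_bounded by (force simp: bounded_iff)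
  have "AE z in P. fst z \<in> measure_support M"
    by (rule AE_distrD[OF fM(1)], unfold d) (rule AE_measure_support[OF M])
  moreover have "AE z in P. snd z \<in> measure_support N"
    by (rule AE_distrD[OF fM(2)], unfold d) (rule AE_measure_support[OF N])
  ultimately have "AE z in P. norm (f z) \<le> B"
    by eventually_elim (rule B, simp add: mem_Times_iff)
  then show ?thesis
    using f_meas by (rule integrable_const_bound)
qed

section \<open>The optimal orthogonal matrix\<close>

text \<open>The inner product of matrices is the Frobenius one; the adjoint of left multiplication
  by \<open>A\<close> is left multiplication by its transpose.\<close>

lemma inner_matrix_mult_left:
  fixes A :: "real^'n^'m" and B :: "real^'k^'n" and C :: "real^'k^'m"
  shows "(A ** B) \<bullet> C = B \<bullet> (transpose A ** C)"
proof -
  have "(A ** B) \<bullet> C = (\<Sum>i\<in>UNIV. \<Sum>j\<in>UNIV. \<Sum>k\<in>UNIV. A $ i $ k * B $ k $ j * C $ i $ j)"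
    by (simp add: inner_vec_def matrix_matrix_mult_def sum_distrib_right)
  also have "\<dots> = (\<Sum>k\<in>UNIV. \<Sum>j\<in>UNIV. \<Sum>i\<in>UNIV. A $ i $ k * B $ k $ j * C $ i $ j)"
    \<comment> \<open>Reversing the order of three sums takes three swaps of neighbours.\<close>
    by (subst sum.swap, subst (2) sum.swap, subst sum.swap) (rule refl)
  also have "\<dots> = B \<bullet> (transpose A ** C)"
    by (simp add: inner_vec_def matrix_matrix_mult_def transpose_def sum_distrib_left ac_simps)
  finally show ?thesis .
qed

lemma inner_transpose:
  fixes A B :: "real^'n^'m"
  shows "transpose A \<bullet> transpose B = A \<bullet> B"
  by (simp add: inner_vec_def transpose_def) (rule sum.swap)

lemma inner_matrix_mult_right:
  fixes A :: "real^'n^'m" and B :: "real^'k^'n" and C :: "real^'k^'m"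
  shows "(A ** B) \<bullet> C = A \<bullet> (C ** transpose B)"
  using inner_matrix_mult_left[of "transpose B" "transpose A" "transpose C"]
  by (metis inner_transpose matrix_transpose_mul transpose_transpose)

lemma orthogonal_matrix_entry_le_1:
  fixes C :: "real^'n^'n"
  assumes "orthogonal_matrix C"
  shows "C $ i $ j \<le> 1"
proof -
  have "norm (C $ i) = 1"
    using assms by (simp add: orthogonal_matrix_orthonormal_rows row_def)
  then show ?thesis
    using component_le_norm_cart[of "C $ i" j] by linarith
qed

lemma inner_svd_le:
  fixes A :: "real^'n^'n"
  assumes svd: "is_svd A U D V" and C: "orthogonal_matrix C"
  shows "C \<bullet> A \<le> (U ** transpose V) \<bullet> A"
proof -
  have U: "orthogonal_matrix U" and V: "orthogonal_matrix V" and A: "A = U ** D ** transpose V"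
    and D: "\<And>i j. i \<noteq> j \<Longrightarrow> D $ i $ j = 0" "\<And>i. 0 \<le> D $ i $ i"
    using svd by (auto simp: is_svd_def)
  \<comment> \<open>Moving \<open>U\<close> and \<open>V\<close> to the other side of the inner
    product leaves only the diagonal matrix \<open>D\<close> to pair with.\<close>
  have rotate: "W \<bullet> A = (transpose U ** W ** V) \<bullet> D" for W
    unfolding A
    using inner_matrix_mult_left[of U "D ** transpose V" W]
      inner_matrix_mult_right[of D "transpose V" "transpose U ** W"]
    by (simp add: inner_commute matrix_mul_assoc)
  have diag: "W \<bullet> D = (\<Sum>i\<in>UNIV. W $ i $ i * D $ i $ i)" for W
  proof -
    have "(\<Sum>j\<in>UNIV. W $ i $ j * D $ i $ j) = W $ i $ i * D $ i $ i" for i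
      using D(1) by (subst sum.remove[of _ i]) (auto intro!: sum.neutral)
    then show ?thesis
      by (simp add: inner_vec_def)
  qed
  have "transpose U ** (U ** transpose V) ** V = (transpose U ** U) ** (transpose V ** V)"
    by (simp add: matrix_mul_assoc)
  then have UV: "transpose U ** (U ** transpose V) ** V = mat 1"
    using U V by (simp add: orthogonal_matrix)
  have "orthogonal_matrix (transpose U ** C ** V)"
    using U V C by (intro orthogonal_matrix_mul) simp_all
  \<comment> \<open>The comparison is made term by term on the diagonal: entries at most 1 against
    the ones of \<open>mat 1\<close>, weighted by the nonnegative singular values.\<close>
  then have "(transpose U ** C ** V) \<bullet> D \<le> mat 1 \<bullet> D"
    unfolding diag using D(2)
    by (intro sum_mono mult_right_mono) (auto simp: mat_def orthogonal_matrix_entry_le_1)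
  then show ?thesis
    unfolding rotate UV .
qed

section \<open>Transport cost and cross moment\<close>

lemma continuous_on_outer_product:
  "continuous_on S (\<lambda>(x, y). columnvector y ** (rowvector x :: real^'d^1) :: real^'d^'d)"
  unfolding columnvector_def rowvector_def matrix_matrix_mult_def case_prod_beta
  by (intro continuous_intros)

text \<open>Turns the mixed term of the expanded square into a linear functional of the outer
  product, so that it can be pulled out of the integral.\<close>

lemma inner_outer_product:
  "C \<bullet> (columnvector y ** (rowvector x :: real^'d^1)) = y \<bullet> (C *v (x :: real^'d))"
  by (simp add: inner_vec_def columnvector_def rowvector_def matrix_matrix_mult_def
      matrix_vector_mult_def sum_distrib_left ac_simps)

lemma continuous_on_matrix_vector_diff_norm:
  "continuous_on S (\<lambda>(x, y). (norm ((C :: real^'m^'n) *v x - y))\<^sup>2)"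
  unfolding case_prod_beta matrix_vector_mult_def by (intro continuous_intros)

context
  fixes X Y :: "(real^'d) set" and M N :: "(real^'d) measure"
  assumes M: "compactly_supported_prob_on X M" and N: "compactly_supported_prob_on Y N"
begin

text \<open>Since \<open>C\<close> preserves norms, it survives only in the mixed term; minimizing
  over \<open>C\<close> thus means maximizing a linear functional.\<close>

lemma transport_cost_orthogonal:
  assumes P: "P \<in> couplings M N" and C: "orthogonal_matrix C"
  shows "transport_cost C P =
    (LINT (x, y)|P. (norm x)\<^sup>2 + (norm y)\<^sup>2) - 2 * (C \<bullet> cross_moment P)"
proof -
  let ?outer = "\<lambda>z :: (real^'d) \<times> (real^'d). columnvector (snd z) ** (rowvector (fst z) :: real^'d^1)"
  have outer: "integrable P ?outer"
    using integrable_coupling_continuous[OF M N P continuous_on_outer_product]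
    by (simp add: case_prod_unfold)
  have norms: "integrable P (\<lambda>z. (norm (fst z))\<^sup>2 + (norm (snd z))\<^sup>2)"
    by (intro integrable_coupling_continuous[OF M N P] continuous_intros)
  have "(norm (C *v x - y))\<^sup>2 = (norm x)\<^sup>2 + (norm y)\<^sup>2 - 2 * (C \<bullet> (?outer (x, y)))" for x y
  proof -
    have "norm (C *v x) = norm x"
      using C by (intro orthogonal_transformation_norm) (simp add: orthogonal_transformation_matrix)
    then have "(C *v x) \<bullet> (C *v x) = x \<bullet> x"
      by (simp add: dot_square_norm)
    then show ?thesis
      by (simp add: inner_outer_product power2_norm_eq_inner inner_diff inner_commute)
  qed
  then have "transport_cost C P =
      (LINT z|P. (norm (fst z))\<^sup>2 + (norm (snd z))\<^sup>2 - 2 * (C \<bullet> ?outer z))"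
    by (simp add: transport_cost_def case_prod_unfold)
  then show ?thesis
    using outer norms by (simp add: cross_moment_def case_prod_unfold)
qed

lemma transport_cost_svd_le:
  assumes "P \<in> couplings M N" and "is_svd (cross_moment P) U D V" and "orthogonal_matrix C"
  shows "transport_cost (U ** transpose V) P \<le> transport_cost C P"
proof -
  have "orthogonal_matrix (U ** transpose V)"
    using assms(2) by (auto simp: is_svd_def intro: orthogonal_matrix_mul)
  then show ?thesis
    using assms inner_svd_le[OF assms(2,3)] by (simp add: transport_cost_orthogonal)
qed

text \<open>The right-hand side is therefore the same for every choice of singular value
  decomposition.\<close>

lemma procrustes_cost_svd:
  assumes "P \<in> couplings M N" and "is_svd (cross_moment P) U D V"
  shows "procrustes_cost P = transport_cost (U ** transpose V) P"
  unfolding procrustes_cost_def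
proof (rule Least_equality)
  show "\<exists>C. orthogonal_matrix C \<and> transport_cost (U ** transpose V) P = transport_cost C P"
    using assms(2) by (auto simp: is_svd_def intro!: exI[of _ "U ** transpose V"] orthogonal_matrix_mul)
qed (use transport_cost_svd_le[OF assms] in auto)

text \<open>With \<open>C\<close> fixed, the cost is an integral against the measure, hence affine
  in it.\<close>

lemma transport_cost_mixture:
  assumes P: "P \<in> couplings M N" and Q: "Q \<in> couplings M N" and t: "t \<in> {0..1}"
  shows "transport_cost C (mixture t P Q) = (1 - t) * transport_cost C P + t * transport_cost C Q"
  unfolding transport_cost_def
proof (rule integral_mixture_nonneg[OF _ t])
  show "sets Q = sets P"
    using P Q by (simp add: couplings_def)
qed (use integrable_coupling_continuous[OF M N _ continuous_on_matrix_vector_diff_norm] P Q in auto)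

end

theorem proposition2p4:
  fixes X Y :: "(real^'d) set"
    and \<alpha> \<beta> :: "(real^'d) measure"
    and U \<Sigma> V :: "((real^'d) \<times> (real^'d)) measure \<Rightarrow> real^'d^'d"
  assumes "compactly_supported_prob_on X \<alpha>"
    and "compactly_supported_prob_on Y \<beta>"
    and "\<And>\<pi>. \<pi> \<in> couplings \<alpha> \<beta> \<Longrightarrow> is_svd (cross_moment \<pi>) (U \<pi>) (\<Sigma> \<pi>) (V \<pi>)"
  shows "concave_on_measures (couplings \<alpha> \<beta>) (svd_cost U V) \<and>
    (\<forall>\<pi>. is_arg_min procrustes_cost (\<lambda>\<pi>. \<pi> \<in> couplings \<alpha> \<beta>) \<pi> \<longleftrightarrow>
         is_arg_min (svd_cost U V) (\<lambda>\<pi>. \<pi> \<in> couplings \<alpha> \<beta>) \<pi>)"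
proof
  show "concave_on_measures (couplings \<alpha> \<beta>) (svd_cost U V)"
    unfolding concave_on_measures_def
  proof (intro ballI conjI)
    fix P Q t assume P: "P \<in> couplings \<alpha> \<beta>" and Q: "Q \<in> couplings \<alpha> \<beta>" and t: "t \<in> {0..1::real}"
    let ?R = "mixture t P Q"
    let ?C = "U ?R ** transpose (V ?R)"
    show R: "?R \<in> couplings \<alpha> \<beta>"
      by (rule mixture_in_couplings[OF P Q t])
    have C: "orthogonal_matrix ?C"
      using assms(3)[OF R] by (auto simp: is_svd_def intro: orthogonal_matrix_mul)
    \<comment> \<open>\<open>?C\<close> is chosen for the mixture, so at \<open>P\<close> and
      \<open>Q\<close> it costs at least as much as the matrices chosen for them.\<close>
    have "(1 - t) * svd_cost U V P + t * svd_cost U V Q \<le>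
        (1 - t) * transport_cost ?C P + t * transport_cost ?C Q"
      unfolding svd_cost_def
      using t C transport_cost_svd_le[OF assms(1,2) P assms(3)[OF P]]
        transport_cost_svd_le[OF assms(1,2) Q assms(3)[OF Q]]
      by (intro add_mono mult_left_mono) auto
    also have "\<dots> = svd_cost U V ?R"
      unfolding svd_cost_def by (rule transport_cost_mixture[OF assms(1,2) P Q t, symmetric])
    finally show "(1 - t) * svd_cost U V P + t * svd_cost U V Q \<le> svd_cost U V ?R" .
  qed
  \<comment> \<open>The two objectives agree at every coupling, and \<open>is_arg_min\<close>
    compares values only there.\<close>
  have "procrustes_cost \<pi> = svd_cost U V \<pi>" if "\<pi> \<in> couplings \<alpha> \<beta>" for \<pi>
    unfolding svd_cost_def by (rule procrustes_cost_svd[OF assms(1,2) that assms(3)[OF that]])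
  then show "\<forall>\<pi>. is_arg_min procrustes_cost (\<lambda>\<pi>. \<pi> \<in> couplings \<alpha> \<beta>) \<pi> \<longleftrightarrow>
      is_arg_min (svd_cost U V) (\<lambda>\<pi>. \<pi> \<in> couplings \<alpha> \<beta>) \<pi>"
    by (auto simp: is_arg_min_def)
qed

end
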